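(* Let $\mathcal{H}$ be a real Hilbert space, $J\in\mathcal{C}$, and let $(u,p)$ be the solution of the gradient flow of $J$ with initial datum $f$. Assume that $p(t)\in\partial J(p(t))$ for all $t>0$. Then for all $0<s\le t$ it holds $p(s)\in\partial J(u(t))$. Moreover, for all $t>0$, $u(t)=v(t)$, where $v(t)$ is the solution of the variational problem $$v(t)=\arg\min_{v\in\mathcal{H}}\ \frac12\|v-f\|^2+tJ(v).$$
   Context: The class $\mathcal{C}$ consists of all maps $J:\mathcal{H}\to\mathbb{R}\cup\{+\infty\}$ that are convex, lower semicontinuous with respect to the strong topology of $\mathcal{H}$, and absolutely one-homogeneous, i.e. $J(cu)=|c|J(u)$ for all $u\in\mathcal{H}$, $c\in\mathbb{R}\setminus\{0\}$, and $J(0)=0$. The subdifferential is $\partial J(u)=\{p\in\mathcal{H}:\langle p,v\rangle\le J(v)\ \forall v\in\mathcal{H},\ \langle p,u\rangle=J(u)\}$, and $\mathrm{dom}(\partial J)=\{u:\partial J(u)\ne\emptyset\}$. Gradient flow: for $f\in\overline{\mathrm{dom}(\partial J)}$, the solution $(u,p)$ of $\partial_tu(t)=-p(t)$, $p(t)\in\partial J(u(t))$, $u(0)=f$ is the unique continuous $u:[0,\infty)\to\mathcal{H}$ with $u(0)=f$ given by Brezis' theory (Lipschitz on $[\delta,\infty)$ for every $\delta>0$, $u(t)\in\mathrm{dom}(\partial J)$ for all $t>0$, right-differentiable at every $t>0$), together with $p(t):=-\partial_t^+u(t)$, which is the element of minimal norm in $\partial J(u(t))$ for every $t>0$. *)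

theory Defs
  imports "HOL-Analysis.Analysis"
begin

text \<open>
  A real Hilbert space is a type of sort \<open>{real_inner, complete_space}\<close>. A functional with
  values in \<open>\<real> \<union> {+\<infinity>}\<close> is a map into \<^typ>\<open>ereal\<close> that avoids \<open>-\<infinity>\<close>.
\<close>

text \<open>
  The convention \<open>0 * \<infinity> = 0\<close> of \<^typ>\<open>ereal\<close> makes the endpoints \<open>\<theta> = 0\<close> and \<open>\<theta> = 1\<close> of the
  convexity inequality trivially true.
\<close>

definition ext_convex :: "('a::real_vector \<Rightarrow> ereal) \<Rightarrow> bool" where
  "ext_convex J \<longleftrightarrow>
     (\<forall>u v. \<forall>\<theta>\<in>{0..1}. J ((1 - \<theta>) *\<^sub>R u + \<theta> *\<^sub>R v) \<le> ereal (1 - \<theta>) * J u + ereal \<theta> * J v)"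

definition lower_semicontinuous :: "('a::topological_space \<Rightarrow> ereal) \<Rightarrow> bool" where
  "lower_semicontinuous J \<longleftrightarrow> (\<forall>u. J u \<le> Liminf (at u) J)"

definition abs_one_homogeneous :: "('a::real_vector \<Rightarrow> ereal) \<Rightarrow> bool" where
  "abs_one_homogeneous J \<longleftrightarrow> (\<forall>u c. c \<noteq> 0 \<longrightarrow> J (c *\<^sub>R u) = ereal \<bar>c\<bar> * J u) \<and> J 0 = 0"

definition class_C :: "('a::{real_inner, complete_space} \<Rightarrow> ereal) set" where
  "class_C = {J. (\<forall>u. J u \<noteq> -\<infinity>) \<and> ext_convex J \<and> lower_semicontinuous J \<and> abs_one_homogeneous J}"

definition subdiff :: "('a::real_inner \<Rightarrow> ereal) \<Rightarrow> 'a \<Rightarrow> 'a set" where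
  "subdiff J u = {p. (\<forall>v. ereal (p \<bullet> v) \<le> J v) \<and> ereal (p \<bullet> u) = J u}"

definition dom_subdiff :: "('a::real_inner \<Rightarrow> ereal) \<Rightarrow> 'a set" where
  "dom_subdiff J = {u. subdiff J u \<noteq> {}}"

text \<open>
  The solution of \<open>u' = - p\<close>, \<open>p \<in> \<partial>J(u)\<close>, \<open>u(0) = f\<close> in the sense of Brezis. Only the values of \<open>u\<close>
  on \<open>[0,\<infinity>)\<close> and those of \<open>p\<close> on \<open>(0,\<infinity>)\<close> matter; \<open>p t\<close> is minus the right derivative of \<open>u\<close> at \<open>t\<close>.
\<close>

definition gradient_flow ::
  "('a::{real_inner, complete_space} \<Rightarrow> ereal) \<Rightarrow> 'a \<Rightarrow> (real \<Rightarrow> 'a) \<Rightarrow> (real \<Rightarrow> 'a) \<Rightarrow> bool" where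
  "gradient_flow J f u p \<longleftrightarrow>
     f \<in> closure (dom_subdiff J) \<and>
     continuous_on {0..} u \<and>
     u 0 = f \<and>
     (\<forall>\<delta>>0. \<exists>L. L-lipschitz_on {\<delta>..} u) \<and>
     (\<forall>t>0. u t \<in> dom_subdiff J) \<and>
     (\<forall>t>0. (u has_vector_derivative - p t) (at_right t)) \<and>
     (\<forall>t>0. p t \<in> subdiff J (u t) \<and> (\<forall>q\<in>subdiff J (u t). norm (p t) \<le> norm q))"

end

theory Submission
  imports Defs
begin

text \<open>
  Call \<open>q\<close> dual feasible if \<open>\<langle>q, v\<rangle> \<le> J v\<close> for all \<open>v\<close>; a subgradient at \<open>w\<close> is a dual feasible
  vector that attains equality at \<open>w\<close>. In particular \<open>J (u t) = \<langle>p t, u t\<rangle>\<close> is a real number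
  for \<open>t > 0\<close>.

  The first claim says that the gap \<open>g t = J (u t) - \<langle>p s, u t\<rangle>\<close>, which is nonnegative and vanishes
  at \<open>t = s\<close>, stays zero for \<open>t \<ge> s\<close>. Formally \<open>g' = - \<parallel>p\<parallel>\<^sup>2 + \<langle>p s, p\<rangle>\<close>, and since \<open>p s\<close> is dual
  feasible and \<open>J (p t) = \<parallel>p t\<parallel>\<^sup>2\<close> by the hypothesis \<open>p t \<in> \<partial>J (p t)\<close>, this is nonpositive; so
  \<open>g\<close> is nonincreasing. To make the formal derivative rigorous it is enough to bound the
  upper right Dini derivative of \<open>g\<close> (lemma \<open>nonincreasing_of_dini\<close>). From \<open>\<langle>p y, u x\<rangle> \<le> J (u x)\<close>
  one gets \<open>J (u y) - J (u x) \<le> \<langle>p y, u y - u x\<rangle>\<close>, where \<open>u y - u x\<close> is \<open>- (y - x) p x\<close> up to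
  \<open>o(y - x)\<close>, so what is missing is \<open>liminf \<langle>p y, p x\<rangle> \<ge> \<parallel>p x\<parallel>\<^sup>2\<close> as \<open>y\<close> decreases to \<open>x\<close>. This
  is where the minimality of \<open>\<parallel>p x\<parallel>\<close> enters: the vectors \<open>p y\<close> are bounded and almost
  subgradients at \<open>u x\<close>, and a weak limit \<open>q\<close> of them is a subgradient at \<open>u x\<close>, whence
  \<open>\<langle>q, p x\<rangle> \<ge> \<parallel>p x\<parallel>\<^sup>2\<close> (lemma \<open>near_subgradient_inner_ge\<close>).

  For the second claim, \<open>f - u t = \<integral> p\<close> over \<open>[0, t]\<close> is \<open>t\<close> times an average of
  vectors which, by the first claim, are all subgradients at \<open>u t\<close>. Hence
  \<open>(f - u t) / t \<in> \<partial>J (u t)\<close>, which is the optimality condition of the strictly convex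
  variational problem.
\<close>

section \<open>Nested convex sets in Hilbert space\<close>

text \<open>
  This replaces weak compactness of bounded sets. Almost minimal-norm points of the sets form a
  Cauchy sequence: the midpoint of two of them lies in the larger set and so has almost minimal
  norm too, and the parallelogram law then bounds their distance.
\<close>

lemma nested_convex_closed_bounded_Inter:
  fixes C :: "nat \<Rightarrow> 'a::{real_inner, complete_space} set"
  assumes ne: "\<And>n. C n \<noteq> {}" and cl: "\<And>n. closed (C n)" and cv: "\<And>n. convex (C n)"
    and dec: "decseq C" and bd: "bounded (C 0)"
  shows "(\<Inter>n. C n) \<noteq> {}"
proof -
  define i where "i n = inverse (real (Suc n))" for n
  have i: "i n > 0" "m \<le> n \<Longrightarrow> i n \<le> i m" for m n by (simp_all add: i_def)
  define d where "d n = (INF x\<in>C n. (norm x)\<^sup>2)" for n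
  have bb: "bdd_below ((\<lambda>x. (norm x)\<^sup>2) ` C n)" for n
    by (rule bdd_belowI2[of _ 0]) simp
  obtain B where B: "\<And>x. x \<in> C 0 \<Longrightarrow> norm x \<le> B" using bd by (auto simp: bounded_iff)
  have sub: "C n \<subseteq> C m" if "m \<le> n" for m n using dec that by (auto simp: decseq_def)
  have dle: "d n \<le> (norm x)\<^sup>2" if "x \<in> C n" for n x
    unfolding d_def by (rule cINF_lower[OF bb that])
  have "incseq d"
    unfolding incseq_def d_def
    by (intro allI impI cINF_superset_mono[OF ne bb sub]) auto
  have dB: "d n \<le> B\<^sup>2" for n
  proof -
    obtain x where x: "x \<in> C n" using ne by blast
    then have "norm x \<le> B" using sub[of 0 n] B by auto
    then have "(norm x)\<^sup>2 \<le> B\<^sup>2" by (simp add: power_mono)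
    with dle[OF x] show ?thesis by simp
  qed
  obtain l where l: "d \<longlonglongrightarrow> l"
    using incseq_convergent[OF \<open>incseq d\<close>] dB by metis
  have dl: "d n \<le> l" for n by (rule incseq_le[OF \<open>incseq d\<close> l])
  have "\<exists>x\<in>C n. (norm x)\<^sup>2 < d n + i n" for n
    using cINF_less_iff[OF ne bb, of n "d n + i n"] by (auto simp: d_def i(1))
  then obtain x where x: "\<And>n. x n \<in> C n"
    and xn: "\<And>n. (norm (x n))\<^sup>2 < d n + i n" by metis
  have close: "(dist (x m) (x n))\<^sup>2 \<le> 4 * (l - d m + i m)" if "m \<le> n" for m n
  proof -
    have "x n \<in> C m" using x[of n] sub[OF that] by auto
    then have "(1/2) *\<^sub>R x m + (1/2) *\<^sub>R x n \<in> C m"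
      using x[of m] cv[of m] by (auto simp: convex_def)
    then have "d m \<le> (norm ((1/2) *\<^sub>R x m + (1/2) *\<^sub>R x n))\<^sup>2" by (rule dle)
    also have "\<dots> = (norm (x m + x n))\<^sup>2 / 4"
      by (simp flip: scaleR_add_right add: power_divide)
    finally have 1: "4 * d m \<le> (norm (x m + x n))\<^sup>2" by simp
    have 2: "(dist (x m) (x n))\<^sup>2 = 2 * (norm (x m))\<^sup>2 + 2 * (norm (x n))\<^sup>2 - (norm (x m + x n))\<^sup>2"
      by (simp add: dist_norm power2_norm_eq_inner inner_diff inner_add inner_commute)
    have 3: "(norm (x n))\<^sup>2 \<le> l + i m"
      using xn[of n] dl[of n] i(2)[OF that] by linarith
    have 4: "(norm (x m))\<^sup>2 \<le> d m + i m" using xn[of m] by simp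
    have "(dist (x m) (x n))\<^sup>2 \<le> 2 * (d m + i m) + 2 * (l + i m) - 4 * d m"
      unfolding 2 by (intro diff_mono add_mono mult_left_mono 1 3 4) simp_all
    also have "\<dots> \<le> 4 * (l - d m + i m)" using dl[of m] by (simp add: algebra_simps)
    finally show ?thesis .
  qed
  have "(\<lambda>m. 4 * (l - d m + i m)) \<longlonglongrightarrow> 4 * (l - l + 0)"
    unfolding i_def by (intro tendsto_intros l LIMSEQ_inverse_real_of_nat)
  then have lim: "(\<lambda>m. 4 * (l - d m + i m)) \<longlonglongrightarrow> 0" by simp
  have "Cauchy x"
  proof (rule metric_CauchyI)
    fix e :: real assume e: "e > 0"
    then have "\<forall>\<^sub>F m in sequentially. 4 * (l - d m + i m) < (e/2)\<^sup>2"
      by (intro order_tendstoD(2)[OF lim]) simp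
    then obtain N where N: "4 * (l - d N + i N) < (e/2)\<^sup>2"
      by (auto simp: eventually_sequentially)
    have "dist (x N) (x n) < e/2" if "N \<le> n" for n
      by (rule power_less_imp_less_base[where n = 2])
        (use close[OF that] N e in auto)
    then show "\<exists>M. \<forall>m\<ge>M. \<forall>n\<ge>M. dist (x m) (x n) < e"
      by (metis dist_triangle_half_r)
  qed
  then obtain z where z: "x \<longlonglongrightarrow> z" by (auto simp: Cauchy_convergent_iff convergent_def)
  have "z \<in> C n" for n
  proof (rule Lim_in_closed_set[OF cl _ _ z])
    show "\<forall>\<^sub>F k in sequentially. x k \<in> C n"
      using x sub by (auto simp: eventually_sequentially intro!: exI[of _ n])
  qed simp
  then show ?thesis by blast
qed

section \<open>Subgradients of minimal norm\<close>

definition dual_feasible :: "('a::real_inner \<Rightarrow> ereal) \<Rightarrow> 'a set" where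
  "dual_feasible J = {q. \<forall>v. ereal (q \<bullet> v) \<le> J v}"

lemma subdiff_eq: "subdiff J w = {q \<in> dual_feasible J. ereal (q \<bullet> w) = J w}"
  by (auto simp: subdiff_def dual_feasible_def)

lemma dual_feasible_inner_le:
  assumes "q \<in> dual_feasible J" "p \<in> subdiff J w"
  shows "q \<bullet> w \<le> p \<bullet> w"
  using assms by (metis (mono_tags, lifting) dual_feasible_def ereal_less_eq(3) mem_Collect_eq subdiff_def)

lemma subdiff_iff_inner_ge:
  assumes "p \<in> subdiff J w"
  shows "q \<in> subdiff J w \<longleftrightarrow> q \<in> dual_feasible J \<and> p \<bullet> w \<le> q \<bullet> w"
proof -
  have "J w = ereal (p \<bullet> w)" using assms by (simp add: subdiff_def)
  then show ?thesis
    using dual_feasible_inner_le[OF _ assms, of q] by (auto simp: subdiff_eq)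
qed

lemma closed_dual_feasible: "closed (dual_feasible J)"
  unfolding dual_feasible_def
  by (intro closed_Collect_all closed_Collect_le continuous_intros)

lemma convex_dual_feasible: "convex (dual_feasible J)"
proof -
  have "convex {q. ereal (q \<bullet> v) \<le> J v}" for v
    using convex_halfspace_le[of v] by (cases "J v") (auto simp: inner_commute)
  moreover have "dual_feasible J = (\<Inter>v. {q. ereal (q \<bullet> v) \<le> J v})"
    by (auto simp: dual_feasible_def)
  ultimately show ?thesis by (auto intro: convex_INT)
qed

lemma convex_subdiff: "convex (subdiff J w)"
proof (cases "subdiff J w = {}")
  case False
  then obtain p where p: "p \<in> subdiff J w" by blast
  have "subdiff J w = dual_feasible J \<inter> {q. p \<bullet> w \<le> w \<bullet> q}"
    using subdiff_iff_inner_ge[OF p] by (auto simp: inner_commute)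
  then show ?thesis
    by (simp add: convex_Int convex_dual_feasible convex_halfspace_ge)
qed simp

text \<open>The first-order condition for the projection of the origin.\<close>

lemma min_norm_inner_ge:
  fixes p q :: "'a::real_inner"
  assumes "convex S" "p \<in> S" "\<And>q. q \<in> S \<Longrightarrow> norm p \<le> norm q" "q \<in> S"
  shows "p \<bullet> p \<le> q \<bullet> p"
proof (rule ccontr)
  assume "\<not> ?thesis"
  then have neg: "(0 - p) \<bullet> (q - p) > 0" by (simp add: inner_diff inner_commute)
  obtain \<theta> where \<theta>: "\<theta> > 0" "\<theta> \<le> 1" "dist (p + \<theta> *\<^sub>R (q - p)) 0 < dist p 0"
    using closer_point_lemma[OF neg] by (metis dist_commute)
  have "p + \<theta> *\<^sub>R (q - p) = (1 - \<theta>) *\<^sub>R p + \<theta> *\<^sub>R q" by (simp add: algebra_simps)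
  also have "\<dots> \<in> S" using assms(1,2,4) \<theta> by (simp add: convex_alt)
  finally show False using assms(3) \<theta> by fastforce
qed

text \<open>
  In the limit of vanishing defect this is the first-order condition for \<open>p\<close>. If it failed for
  every \<open>d\<close>, the sets of counterexamples with defect \<open>1 / n\<close> would be nested, closed, convex
  and bounded, and a common point would be a subgradient that violates that condition.
\<close>

lemma near_subgradient_inner_ge:
  fixes p w :: "'a::{real_inner, complete_space}"
  assumes p: "p \<in> subdiff J w" and min: "\<And>q. q \<in> subdiff J w \<Longrightarrow> norm p \<le> norm q"
    and e: "e > 0"
  obtains d where "d > 0"
    "\<And>q. \<lbrakk>q \<in> dual_feasible J; norm q \<le> B; p \<bullet> w - d \<le> q \<bullet> w\<rbrakk> \<Longrightarrow> p \<bullet> p - e < q \<bullet> p"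
proof (rule ccontr)
  note found = that
  assume "\<not> thesis"
  then have bad: "\<exists>q. q \<in> dual_feasible J \<and> norm q \<le> B \<and> p \<bullet> w - d \<le> q \<bullet> w \<and> q \<bullet> p \<le> p \<bullet> p - e"
    if "d > 0" for d
    using \<open>\<not> thesis\<close> found[OF that] by (meson not_le)
  define C where "C n = dual_feasible J \<inter> cball 0 B \<inter> {q. w \<bullet> q \<ge> p \<bullet> w - inverse (Suc n)}
    \<inter> {q. p \<bullet> q \<le> p \<bullet> p - e}" for n :: nat
  have "C n \<noteq> {}" for n
    using bad[of "inverse (Suc n)"] by (auto simp: C_def inner_commute)
  moreover have "closed (C n)" for n
    unfolding C_def
    by (intro closed_Int closed_dual_feasible closed_cball closed_halfspace_ge closed_halfspace_le)
  moreover have "convex (C n)" for n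
    unfolding C_def
    by (intro convex_Int convex_dual_feasible convex_cball convex_halfspace_ge convex_halfspace_le)
  moreover have "decseq C"
  proof (rule decseq_SucI)
    fix n
    have le: "inverse (real (Suc (Suc n))) \<le> inverse (real (Suc n))" by simp
    show "C (Suc n) \<subseteq> C n"
    proof
      fix q assume q: "q \<in> C (Suc n)"
      then have "p \<bullet> w - inverse (real (Suc (Suc n))) \<le> w \<bullet> q" by (simp add: C_def)
      with le have "p \<bullet> w - inverse (real (Suc n)) \<le> w \<bullet> q" by linarith
      with q show "q \<in> C n" by (simp add: C_def)
    qed
  qed
  moreover have "bounded (C 0)"
    by (rule bounded_subset[OF bounded_cball]) (auto simp: C_def)
  ultimately have "(\<Inter>n. C n) \<noteq> {}"
    by (rule nested_convex_closed_bounded_Inter)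
  then obtain q where q: "\<And>n. q \<in> C n" by blast
  have "p \<bullet> w \<le> q \<bullet> w + 0"
  proof (rule LIMSEQ_le_const)
    show "(\<lambda>n. q \<bullet> w + inverse (Suc n)) \<longlonglongrightarrow> q \<bullet> w + 0"
      by (intro tendsto_intros LIMSEQ_inverse_real_of_nat)
    show "\<exists>N. \<forall>n\<ge>N. p \<bullet> w \<le> q \<bullet> w + inverse (Suc n)"
      using q by (auto simp: C_def inner_commute algebra_simps)
  qed
  then have "q \<in> subdiff J w"
    using q[of 0] subdiff_iff_inner_ge[OF p] by (simp add: C_def)
  then have "p \<bullet> p \<le> q \<bullet> p"
    using min_norm_inner_ge[OF convex_subdiff p min] by blast
  then show False using q[of 0] e by (simp add: C_def inner_commute)
qed

section \<open>One-sided derivatives and monotonicity\<close>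

text \<open>
  Allow an arbitrarily small slope \<open>e\<close> from a starting point \<open>c\<close>. By continuity there is a last
  point with \<open>g x \<le> g c + e (x - c)\<close>, and it must be \<open>b\<close>, since at an earlier point the Dini
  bound would continue the inequality to the right. Leaving out the left endpoint in the Dini bound costs only one
  more passage to the limit.
\<close>

lemma nonincreasing_of_dini:
  fixes g :: "real \<Rightarrow> real"
  assumes ab: "a \<le> b" and cont: "continuous_on {a..b} g"
    and dini: "\<And>x e. \<lbrakk>a < x; x < b; e > 0\<rbrakk> \<Longrightarrow> \<forall>\<^sub>F y in at_right x. g y \<le> g x + e * (y - x)"
  shows "g b \<le> g a"
proof (cases "a = b")
  case False
  then have "a < b" using ab by simp
  have tilted: "g b \<le> g c + e * (b - c)" if c: "a < c" "c < b" and e: "e > 0" for c e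
  proof -
    define S where "S = {x \<in> {c..b}. g x \<le> g c + e * (x - c)}"
    have "continuous_on {c..b} g" using cont c by (auto intro: continuous_on_subset)
    then have "closed S"
      unfolding S_def by (intro continuous_on_closed_Collect_le continuous_intros) auto
    moreover have "c \<in> S" using c by (simp add: S_def)
    moreover have "bdd_above S" by (auto simp: S_def intro: bdd_aboveI[of _ b])
    ultimately have sup: "Sup S \<in> S" using closed_contains_Sup by blast
    have "Sup S = b"
    proof (rule ccontr)
      assume "Sup S \<noteq> b"
      then have lt: "Sup S < b" and ge: "c \<le> Sup S" using sup by (auto simp: S_def)
      have "\<forall>\<^sub>F y in at_right (Sup S). g y \<le> g (Sup S) + e * (y - Sup S)"
        using dini lt ge c e by auto
      moreover have "\<forall>\<^sub>F y in at_right (Sup S). y \<in> {Sup S<..<b}"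
        by (rule eventually_at_right_real[OF lt])
      ultimately have "\<forall>\<^sub>F y in at_right (Sup S).
          g y \<le> g (Sup S) + e * (y - Sup S) \<and> y \<in> {Sup S<..<b}"
        by (rule eventually_conj)
      then obtain y where y: "g y \<le> g (Sup S) + e * (y - Sup S)" "Sup S < y" "y < b"
        using eventually_happens trivial_limit_at_right_real by fastforce
      have "y \<in> S" using y sup ge by (auto simp: S_def algebra_simps)
      then have "y \<le> Sup S" using \<open>bdd_above S\<close> by (rule cSup_upper)
      then show False using y by simp
    qed
    then show ?thesis using sup by (simp add: S_def)
  qed
  have "g b \<le> g c" if "a < c" "c < b" for c
  proof (rule field_le_epsilon)
    fix e :: real assume "e > 0"
    then show "g b \<le> g c + e" using tilted[OF that, of "e / (b - c)"] that by simp
  qed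
  then have "\<forall>\<^sub>F c in at_right a. g b \<le> g c"
    using eventually_at_right_real[OF \<open>a < b\<close>] by (auto elim: eventually_mono)
  moreover have "(g \<longlongrightarrow> g a) (at_right a)"
    using cont \<open>a < b\<close> by (simp add: continuous_on_Icc_at_rightD)
  ultimately show ?thesis
    by (intro tendsto_lowerbound) auto
qed simp

lemma right_derivative_dini:
  fixes u :: "real \<Rightarrow> 'a::real_normed_vector"
  assumes "(u has_vector_derivative D) (at_right x)" "e > 0"
  shows "\<forall>\<^sub>F y in at_right x. norm (u y - u x - (y - x) *\<^sub>R D) \<le> e * (y - x)"
  using assms unfolding has_vector_derivative_def has_derivative_within_alt2
  by (auto elim!: allE[of _ e] eventually_elim2[OF _ eventually_at_right_less])

lemma nonincreasing_of_right_derivative: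
  fixes g :: "real \<Rightarrow> real"
  assumes "a \<le> b" "continuous_on {a..b} g"
    and der: "\<And>x. \<lbrakk>a < x; x < b\<rbrakk> \<Longrightarrow> (g has_vector_derivative g' x) (at_right x)"
    and neg: "\<And>x. \<lbrakk>a < x; x < b\<rbrakk> \<Longrightarrow> g' x \<le> 0"
  shows "g b \<le> g a"
proof (rule nonincreasing_of_dini[OF assms(1,2)])
  fix x e :: real assume x: "a < x" "x < b" and e: "e > 0"
  show "\<forall>\<^sub>F y in at_right x. g y \<le> g x + e * (y - x)"
    using right_derivative_dini[OF der[OF x] e] eventually_at_right_less[of x]
  proof eventually_elim
    case (elim y)
    have "(y - x) * g' x \<le> 0"
      using neg[OF x] elim by (simp add: mult_nonneg_nonpos)
    then show ?case using elim by (simp add: abs_le_iff)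
  qed
qed

lemma lipschitz_right_derivative_bound:
  fixes u :: "real \<Rightarrow> 'a::real_normed_vector"
  assumes lip: "L-lipschitz_on {a..} u" and "a \<le> x"
    and der: "(u has_vector_derivative D) (at_right x)"
  shows "norm D \<le> L"
proof (rule field_le_epsilon)
  fix e :: real assume "e > 0"
  then have "\<forall>\<^sub>F y in at_right x. norm (u y - u x - (y - x) *\<^sub>R D) \<le> e * (y - x) \<and> x < y"
    by (intro eventually_conj right_derivative_dini[OF der] eventually_at_right_less)
  then obtain y where y: "norm (u y - u x - (y - x) *\<^sub>R D) \<le> e * (y - x)" "x < y"
    using eventually_happens trivial_limit_at_right_real by blast
  have "norm (u y - u x) \<le> L * (y - x)"
    using lipschitz_onD[OF lip, of y x] y \<open>a \<le> x\<close> by (simp add: dist_norm)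
  moreover have "(y - x) * norm D \<le> norm (u y - u x) + norm (u y - u x - (y - x) *\<^sub>R D)"
    using norm_triangle_ineq4[of "u y - u x" "u y - u x - (y - x) *\<^sub>R D"] y by simp
  ultimately have "(y - x) * norm D \<le> (y - x) * (L + e)"
    using y by (simp add: algebra_simps)
  then show "norm D \<le> L + e" using y by simp
qed

section \<open>Energy and velocity along the flow\<close>

text \<open>
  Two subgradients \<open>p x\<close> and \<open>p y\<close> of norm at most \<open>L\<close> bound the increment of \<open>J\<close> from both
  sides; hence \<open>J\<close> inherits Lipschitz continuity along the flow from \<open>u\<close>.
\<close>

lemma subgradient_increment_bound:
  fixes u p :: "real \<Rightarrow> 'a::real_inner"
  assumes "p x \<in> subdiff J (u x)" "p y \<in> subdiff J (u y)" "norm (p x) \<le> L" "norm (p y) \<le> L"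
  shows "\<bar>p y \<bullet> u y - p x \<bullet> u x\<bar> \<le> L * norm (u y - u x)"
proof -
  have bound: "q \<bullet> (u y - u x) \<le> L * norm (u y - u x) \<and> - (q \<bullet> (u y - u x)) \<le> L * norm (u y - u x)"
    if "norm q \<le> L" for q
    using Cauchy_Schwarz_ineq2[of q "u y - u x"] mult_right_mono[OF that, of "norm (u y - u x)"]
    by (auto simp: abs_le_iff)
  have "p y \<bullet> u x \<le> p x \<bullet> u x" "p x \<bullet> u y \<le> p y \<bullet> u y"
    using assms by (auto intro!: dual_feasible_inner_le simp: subdiff_eq)
  then show ?thesis
    using bound[OF assms(3)] bound[OF assms(4)] by (auto simp: inner_diff_right abs_le_iff)
qed

lemma gradient_flow_bounded_velocity:
  assumes "gradient_flow J f u p" "a > 0"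
  obtains L where "L-lipschitz_on {a..} u" "\<And>t. a \<le> t \<Longrightarrow> norm (p t) \<le> L"
proof -
  obtain L where L: "L-lipschitz_on {a..} u" using assms by (auto simp: gradient_flow_def)
  have "norm (p t) \<le> L" if "a \<le> t" for t
    using lipschitz_right_derivative_bound[OF L that, of "- p t"] assms that
    by (simp add: gradient_flow_def)
  with L show thesis by (rule that)
qed

lemma gradient_flow_energy_continuous:
  assumes flow: "gradient_flow J f u p" and "a > 0"
  shows "continuous_on {a..} (\<lambda>t. p t \<bullet> u t)"
proof -
  obtain L where L: "L-lipschitz_on {a..} u" and pL: "\<And>t. a \<le> t \<Longrightarrow> norm (p t) \<le> L"
    using gradient_flow_bounded_velocity[OF assms] by blast
  have "(L * L)-lipschitz_on {a..} (\<lambda>t. p t \<bullet> u t)"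
  proof (rule lipschitz_onI)
    fix x y assume xy: "x \<in> {a..}" "y \<in> {a..}"
    have "\<bar>p x \<bullet> u x - p y \<bullet> u y\<bar> \<le> L * norm (u x - u y)"
      using flow xy \<open>a > 0\<close> pL
      by (intro subgradient_increment_bound[where J = J]) (auto simp: gradient_flow_def)
    also have "\<dots> \<le> L * (L * dist x y)"
      using lipschitz_onD[OF L xy] lipschitz_on_nonneg[OF L]
      by (intro mult_left_mono) (auto simp: dist_norm)
    finally show "dist (p x \<bullet> u x) (p y \<bullet> u y) \<le> L * L * dist x y"
      by (simp add: dist_real_def)
  qed simp
  then show ?thesis by (rule lipschitz_on_continuous_on)
qed

text \<open>
  Lower weak right semicontinuity of the velocity, tested against its own value: for \<open>y\<close> close to
  \<open>x\<close> the vector \<open>p y\<close> is a near-subgradient at \<open>u x\<close>, because both \<open>u\<close> and \<open>J\<close> are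
  continuous along the flow.
\<close>

lemma gradient_flow_velocity_right_lsc:
  assumes flow: "gradient_flow J f u p" and x: "x > 0" and e: "e > 0"
  shows "\<forall>\<^sub>F y in at_right x. p x \<bullet> p x - e < p y \<bullet> p x"
proof -
  have sub: "p t \<in> subdiff J (u t)" and min: "q \<in> subdiff J (u t) \<Longrightarrow> norm (p t) \<le> norm q"
    if "t > 0" for t q
    using flow that by (auto simp: gradient_flow_def)
  obtain L where L: "L-lipschitz_on {x..} u" and pL: "\<And>t. x \<le> t \<Longrightarrow> norm (p t) \<le> L"
    using gradient_flow_bounded_velocity[OF flow x] by blast
  obtain d where d: "d > 0"
    and near: "\<And>q. \<lbrakk>q \<in> dual_feasible J; norm q \<le> L; p x \<bullet> u x - d \<le> q \<bullet> u x\<rbrakk>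
      \<Longrightarrow> p x \<bullet> p x - e < q \<bullet> p x"
    using near_subgradient_inner_ge[OF sub[OF x] min[OF x] e] by blast
  have "continuous_on {x..} u" using L by (rule lipschitz_on_continuous_on)
  then have "((\<lambda>y. 2 * L * norm (u y - u x)) \<longlongrightarrow> 2 * L * norm (u x - u x)) (at x within {x..})"
    by (intro tendsto_intros) (simp add: continuous_on_def)
  then have "((\<lambda>y. 2 * L * norm (u y - u x)) \<longlongrightarrow> 0) (at_right x)"
    by (auto intro: tendsto_within_subset)
  then have "\<forall>\<^sub>F y in at_right x. 2 * L * norm (u y - u x) < d"
    using d by (rule order_tendstoD)
  then show ?thesis using eventually_at_right_less[of x]
  proof eventually_elim
    case (elim y)
    then have y: "0 < y" "x \<le> y" using x by auto
    have "\<bar>p y \<bullet> u y - p x \<bullet> u x\<bar> \<le> L * norm (u y - u x)"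
      using sub x y pL by (intro subgradient_increment_bound[where J = J]) auto
    moreover have "p y \<bullet> (u y - u x) \<le> L * norm (u y - u x)"
      using norm_cauchy_schwarz[of "p y" "u y - u x"]
        mult_right_mono[OF pL[OF y(2)], of "norm (u y - u x)"] by simp
    ultimately have "p x \<bullet> u x - d \<le> p y \<bullet> u x"
      using elim by (simp add: inner_diff_right)
    then show ?case using near pL y sub[of y] by (auto simp: subdiff_eq)
  qed
qed

text \<open>
  The one-sided energy dissipation estimate \<open>(J \<circ> u)' \<le> - \<parallel>p\<parallel>\<^sup>2\<close> in Dini form, with a linear
  term \<open>\<langle>q, u\<rangle>\<close> subtracted.
\<close>

lemma gradient_flow_energy_dini:
  assumes flow: "gradient_flow J f u p" and x: "x > 0" and e: "e > 0"
    and q: "q \<bullet> p x \<le> p x \<bullet> p x"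
  shows "\<forall>\<^sub>F y in at_right x.
    p y \<bullet> u y - q \<bullet> u y \<le> p x \<bullet> u x - q \<bullet> u x + e * (y - x)"
proof -
  have sub: "p t \<in> subdiff J (u t)" if "t > 0" for t
    using flow that by (auto simp: gradient_flow_def)
  obtain L where pL: "\<And>t. x \<le> t \<Longrightarrow> norm (p t) \<le> L"
    using gradient_flow_bounded_velocity[OF flow x] by blast
  define M where "M = L + norm q + 1"
  have M: "M > 0" using order_trans[OF norm_ge_zero pL[of x]] norm_ge_zero[of q]
    by (simp add: M_def add_nonneg_pos)
  \<comment> \<open>The slope \<open>e\<close> is shared between the linearisation error of \<open>u\<close>, which is multiplied by
    \<open>\<parallel>p y - q\<parallel> \<le> M\<close>, and the defect of \<open>\<langle>p y, p x\<rangle> \<ge> \<parallel>p x\<parallel>\<^sup>2\<close>.\<close>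
  have "(u has_vector_derivative - p x) (at_right x)"
    using flow x by (simp add: gradient_flow_def)
  then have lin: "\<forall>\<^sub>F y in at_right x.
      norm (u y - u x - (y - x) *\<^sub>R (- p x)) \<le> e / (2 * M) * (y - x)"
    using e M by (intro right_derivative_dini) auto
  have "\<forall>\<^sub>F y in at_right x. p x \<bullet> p x - e / 2 < p y \<bullet> p x"
    using gradient_flow_velocity_right_lsc[OF flow x] e by simp
  with lin show ?thesis using eventually_at_right_less[of x]
  proof eventually_elim
    case (elim y)
    define R where "R = u y - u x - (y - x) *\<^sub>R (- p x)"
    have pq: "norm (p y - q) \<le> M"
      using pL[of y] elim norm_triangle_ineq4[of "p y" q] by (simp add: M_def)
    have "(p y - q) \<bullet> R \<le> norm (p y - q) * norm R" by (rule norm_cauchy_schwarz)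
    also have "\<dots> \<le> M * (e / (2 * M) * (y - x))"
      using elim pq M by (intro mult_mono) (auto simp: R_def)
    finally have R: "(p y - q) \<bullet> R \<le> e / 2 * (y - x)" using M by simp
    have "(y - x) * (q \<bullet> p x - p y \<bullet> p x) \<le> (y - x) * (e / 2)"
      using elim q by (intro mult_left_mono) auto
    moreover have "(p y - q) \<bullet> (u y - u x)
        = (y - x) * (q \<bullet> p x - p y \<bullet> p x) + (p y - q) \<bullet> R"
      by (simp add: R_def inner_simps algebra_simps)
    moreover have "p y \<bullet> u x \<le> p x \<bullet> u x"
      using sub x elim by (intro dual_feasible_inner_le[of _ J]) (auto simp: subdiff_eq)
    ultimately show ?case using R by (simp add: inner_simps algebra_simps)
  qed
qed

section \<open>Persistence of subgradients\<close>

text \<open>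
  The gap \<open>J (u r) - \<langle>p s, u r\<rangle>\<close> is nonincreasing in \<open>r\<close>, because \<open>\<langle>p s, p r\<rangle> \<le> J (p r) = \<parallel>p r\<parallel>\<^sup>2\<close>;
  it is zero at \<open>r = s\<close>.
\<close>

lemma gradient_flow_subgradient_persists:
  assumes flow: "gradient_flow J f u p"
    and eig: "\<And>t. t > 0 \<Longrightarrow> p t \<in> subdiff J (p t)"
    and st: "0 < s" "s \<le> t"
  shows "p s \<in> subdiff J (u t)"
proof -
  have sub: "p r \<in> subdiff J (u r)" if "r > 0" for r
    using flow that by (auto simp: gradient_flow_def)
  have ps: "p s \<in> dual_feasible J" using sub[OF st(1)] by (simp add: subdiff_eq)
  have "p t \<bullet> u t - p s \<bullet> u t \<le> p s \<bullet> u s - p s \<bullet> u s"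
  proof (rule nonincreasing_of_dini[OF st(2)])
    have "continuous_on {s..t} (\<lambda>r. p r \<bullet> u r)"
      using gradient_flow_energy_continuous[OF flow st(1)] by (rule continuous_on_subset) auto
    moreover have "continuous_on {s..t} u"
      using flow st by (auto simp: gradient_flow_def intro: continuous_on_subset)
    ultimately show "continuous_on {s..t} (\<lambda>r. p r \<bullet> u r - p s \<bullet> u r)"
      by (intro continuous_on_diff continuous_on_inner[OF continuous_on_const])
    fix x e :: real assume x: "s < x" "x < t" and e: "e > 0"
    then have x0: "x > 0" using st by simp
    have "p s \<bullet> p x \<le> p x \<bullet> p x" using ps eig[OF x0] by (rule dual_feasible_inner_le)
    then show "\<forall>\<^sub>F y in at_right x. p y \<bullet> u y - p s \<bullet> u y \<le> p x \<bullet> u x - p s \<bullet> u x + e * (y - x)"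
      by (rule gradient_flow_energy_dini[OF flow x0 e])
  qed
  then show ?thesis
    using ps subdiff_iff_inner_ge[OF sub[of t]] st by simp
qed

section \<open>The variational problem\<close>

text \<open>
  The identity \<open>f - u t = \<integral> p\<close> over \<open>[0, t]\<close>, tested against a fixed \<open>v\<close>. Since \<open>p\<close> may be
  unbounded near \<open>0\<close>, the integral is replaced by the monotonicity of the scalar function
  \<open>r \<mapsto> - \<langle>u r, v\<rangle> - r c\<close>, which is continuous up to \<open>0\<close>.
\<close>

lemma gradient_flow_displacement_le:
  assumes flow: "gradient_flow J f u p" and t: "t \<ge> 0"
    and le: "\<And>r. \<lbrakk>0 < r; r < t\<rbrakk> \<Longrightarrow> p r \<bullet> v \<le> c"
  shows "(f - u t) \<bullet> v \<le> t * c"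
proof -
  have "- (u t \<bullet> v) - t * c \<le> - (u 0 \<bullet> v) - 0 * c"
  proof (rule nonincreasing_of_right_derivative[OF t, where g' = "\<lambda>r. p r \<bullet> v - c"])
    have "continuous_on {0..t} u"
      using flow by (auto simp: gradient_flow_def intro: continuous_on_subset)
    then show "continuous_on {0..t} (\<lambda>r. - (u r \<bullet> v) - r * c)"
      by (intro continuous_intros)
    fix x assume x: "0 < x" "x < t"
    then have "(u has_vector_derivative - p x) (at_right x)"
      using flow by (simp add: gradient_flow_def)
    then have "((\<lambda>r. u r \<bullet> v) has_vector_derivative - p x \<bullet> v) (at_right x)"
      by (rule bounded_linear.has_vector_derivative[OF bounded_linear_inner_left])
    then show "((\<lambda>r. - (u r \<bullet> v) - r * c) has_vector_derivative p x \<bullet> v - c) (at_right x)"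
      by (auto intro!: derivative_eq_intros)
    show "p x \<bullet> v - c \<le> 0" using le[OF x] by simp
  qed
  then show ?thesis using flow by (simp add: gradient_flow_def inner_diff_left)
qed

text \<open>
  The optimality condition \<open>(f - w) / t \<in> \<partial>J w\<close>, written without the division. Bounding \<open>J v\<close>
  below by its affine minorant and completing the square leaves the surplus
  \<open>\<parallel>v - w\<parallel>\<^sup>2 / 2\<close>, which is positive unless \<open>v = w\<close>.
\<close>

lemma proximal_arg_min_iff:
  fixes J :: "'a::real_inner \<Rightarrow> ereal"
  assumes feasible: "\<And>v. ereal ((f - w) \<bullet> v) \<le> ereal t * J v"
    and attained: "ereal ((f - w) \<bullet> w) = ereal t * J w"
  shows "is_arg_min (\<lambda>v. ereal (1/2 * (norm (v - f))\<^sup>2) + ereal t * J v) (\<lambda>_. True) v \<longleftrightarrow> v = w"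
proof -
  let ?F = "\<lambda>v. ereal (1/2 * (norm (v - f))\<^sup>2) + ereal t * J v"
  have lower: "?F w + ereal (1/2 * (norm (z - w))\<^sup>2) \<le> ?F z" for z
  proof -
    have "1/2 * (norm (w - f))\<^sup>2 + (f - w) \<bullet> w + 1/2 * (norm (z - w))\<^sup>2
        = 1/2 * (norm (z - f))\<^sup>2 + (f - w) \<bullet> z"
      by (simp add: power2_norm_eq_inner inner_simps inner_commute algebra_simps)
    then have "?F w + ereal (1/2 * (norm (z - w))\<^sup>2)
        = ereal (1/2 * (norm (z - f))\<^sup>2) + ereal ((f - w) \<bullet> z)"
      by (simp flip: attained)
    also have "\<dots> \<le> ?F z" by (intro add_left_mono feasible)
    finally show ?thesis .
  qed
  have fin: "?F w \<noteq> \<infinity>" "?F w \<noteq> - \<infinity>" by (simp_all flip: attained)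
  have "?F w < ?F z" if "z \<noteq> w" for z
  proof -
    have "?F w < ?F w + ereal (1/2 * (norm (z - w))\<^sup>2)"
      using fin that by (simp flip: attained)
    then show ?thesis using lower by (rule less_le_trans)
  qed
  then show ?thesis
    unfolding is_arg_min_def by (metis less_asym)
qed

theorem theorem4p5:
  fixes J :: "'a::{real_inner, complete_space} \<Rightarrow> ereal"
    and f :: 'a
    and u p :: "real \<Rightarrow> 'a"
  assumes "J \<in> class_C"
    and "gradient_flow J f u p"
    and "\<And>t. t > 0 \<Longrightarrow> p t \<in> subdiff J (p t)"
  shows "(\<forall>s t. 0 < s \<and> s \<le> t \<longrightarrow> p s \<in> subdiff J (u t)) \<and>
         (\<forall>t>0. \<forall>v. is_arg_min (\<lambda>w. ereal (1/2 * (norm (w - f))\<^sup>2) + ereal t * J w) (\<lambda>_. True) v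
                   \<longleftrightarrow> v = u t)"
proof -
  note flow = assms(2)
  have persists: "p s \<in> subdiff J (u t)" if "0 < s" "s \<le> t" for s t
    by (rule gradient_flow_subgradient_persists[OF flow assms(3) that])
  have "is_arg_min (\<lambda>w. ereal (1/2 * (norm (w - f))\<^sup>2) + ereal t * J w) (\<lambda>_. True) v
      \<longleftrightarrow> v = u t" if t: "t > 0" for t v
  proof (rule proximal_arg_min_iff)
    have sub: "p r \<in> subdiff J (u r)" if "r > 0" for r
      using persists that by simp
    have lower: "ereal (p r \<bullet> z) \<le> J z" if "r > 0" for r z
      using sub[OF that] by (simp add: subdiff_def)
    have upper: "(f - u t) \<bullet> z \<le> t * c" if "J z = ereal c" for z c
    proof (rule gradient_flow_displacement_le[OF flow])
      fix r :: real assume "0 < r"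
      then show "p r \<bullet> z \<le> c" using lower[of r z] that by simp
    qed (use t in simp)
    have real: "J (u t) = ereal (p t \<bullet> u t)" using sub[OF t] by (simp add: subdiff_def)
    show "ereal ((f - u t) \<bullet> z) \<le> ereal t * J z" for z
    proof (cases "J z")
      case (real c)
      then show ?thesis using upper by simp
    next
      case MInf
      then show ?thesis using lower[OF t, of z] by simp
    qed (use t in simp)
    \<comment> \<open>Here persistence enters: \<open>\<langle>p r, u t\<rangle>\<close> equals \<open>J (u t)\<close> for all earlier times \<open>r\<close>, so the
      displacement bound also holds in the direction \<open>- u t\<close>.\<close>
    have "(f - u t) \<bullet> (- u t) \<le> t * (- (p t \<bullet> u t))"
    proof (rule gradient_flow_displacement_le[OF flow])
      fix r assume r: "0 < r" "r < t"
      then have "ereal (p r \<bullet> u t) = J (u t)" using persists[of r t] by (simp add: subdiff_def)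
      then show "p r \<bullet> (- u t) \<le> - (p t \<bullet> u t)" using real by simp
    qed (use t in simp)
    then show "ereal ((f - u t) \<bullet> u t) = ereal t * J (u t)"
      using upper[OF real] real by simp
  qed
  with persists show ?thesis by blast
qed

end
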